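(* Let $N\ge 2$. For each integer $n\ge1$ let $(X^{(n)}_k)_{k\in\mathbb{N}_0}$ be the discrete coagulation-fragmentation Markov chain on $S_{N-1}^{(n)}=n\Delta_{N-1}\cap\mathbb{Z}^N$, let $Y^{(n)}_k=n^{-1}X^{(n)}_k\in\Delta_{N-1}$, and let $\mu_0^{(n)}$ be the distribution of $Y_0^{(n)}$. Let $(X^{(\infty)}_k)_{k\in\mathbb{N}_0}$ be the continuous-space coagulation-fragmentation Markov chain on $\Delta_{N-1}$ with initial distribution $\mu_0^{(\infty)}$. Assume the weak convergence $\mu_0^{(n)}\Longrightarrow\mu_0^{(\infty)}$ as $n\to\infty$. Then for each $k\in\mathbb{N}$ the one-dimensional (single-time) marginals converge weakly: $$Y_k^{(n)}\Longrightarrow X_k^{(\infty)}\quad\text{as } n\to\infty .$$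
   Context: The simplex is $\Delta_{N-1}=\{\mathbf{x}=(x_1,\ldots,x_N): x_i\ge 0 \text{ for all } i,\ \sum_{i=1}^N x_i=1\}$, and $S_{N-1}^{(n)}=n\Delta_{N-1}\cap\mathbb{Z}^N=\{\mathbf{n}=(n_1,\ldots,n_N): n_i\in\mathbb{N}_0,\ \sum_{i=1}^N n_i=n\}$. Discrete chain: the discrete coagulation-fragmentation Markov chain on $S_{N-1}^{(n)}$ is the time-homogeneous chain with one-step transition probabilities from $\mathbf{n}$ to $\mathbf{n}'$ given by $$\sum_{(i,j):\, i\ne j}\frac{1}{N}\,\frac{1}{N-1}\,\frac{1}{n_i+n_j+1}\,\delta_{n_i+n_j,\;n_i'+n_j'}\prod_{k\ne i,j}\delta_{n_k',\,n_k},$$ where the sum is over all ordered pairs $(i,j)$ of distinct indices in $\{1,\ldots,N\}$ and $\delta_{a,b}$ is the Kronecker delta. Continuous-space chain: the coagulation-fragmentation Markov chain on $\Delta_{N-1}$ is the time-homogeneous discrete-time chain with the following one-step dynamics. Given the current state $\mathbf{x}=(x_1,\ldots,x_N)$, choose an ordered pair $(i,j)$ of distinct indices in $\{1,\ldots,N\}$ uniformly at random (each with probability $\frac{1}{N(N-1)}$) and, independently, $u$ uniformly distributed on $[0,1]$, both independent of the past. The next state has $i$-th coordinate $u(x_i+x_j)$, $j$-th coordinate $(1-u)(x_i+x_j)$, and all other coordinates equal to those of $\mathbf{x}$. *)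

theory Defs
  imports "HOL-Probability.Probability"
begin

text \<open>The number of coordinates \<open>N\<close> is \<open>CARD('n)\<close>, and coordinates are indexed by \<open>'n\<close>.\<close>

definition std_simplex :: "(real ^ 'n) set" where
  "std_simplex = {x. (\<forall>i. 0 \<le> x $ i) \<and> (\<Sum>i\<in>UNIV. x $ i) = 1}"

definition discrete_simplex :: "nat \<Rightarrow> (nat ^ 'n) set" where
  "discrete_simplex n = {v. (\<Sum>i\<in>UNIV. v $ i) = n}"

definition discrete_trans :: "nat ^ 'n \<Rightarrow> nat ^ 'n \<Rightarrow> real" where
  "discrete_trans v v' =
     (\<Sum>(i, j) \<in> {(i, j). i \<noteq> j}.
        (1 / real CARD('n)) * (1 / (real CARD('n) - 1)) * (1 / real (v $ i + v $ j + 1))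
        * of_bool (v $ i + v $ j = v' $ i + v' $ j)
        * (\<Prod>k \<in> UNIV - {i, j}. of_bool (v' $ k = v $ k)))"

definition discrete_coag_frag_chain ::
    "nat \<Rightarrow> 'a measure \<Rightarrow> (nat \<Rightarrow> 'a \<Rightarrow> nat ^ 'n) \<Rightarrow> bool" where
  "discrete_coag_frag_chain n M X \<longleftrightarrow>
     prob_space M \<and>
     (\<forall>k. X k \<in> M \<rightarrow>\<^sub>M count_space (discrete_simplex n)) \<and>
     (\<forall>k s. \<forall>v' \<in> discrete_simplex n.
        \<P>(\<omega> in M. \<forall>l\<le>k. X l \<omega> = s l) \<noteq> 0 \<longrightarrow>
        \<P>(\<omega> in M. X (Suc k) \<omega> = v' \<bar> \<forall>l\<le>k. X l \<omega> = s l) = discrete_trans (s k) v')"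

definition coag_frag_step :: "real ^ 'n \<Rightarrow> 'n \<Rightarrow> 'n \<Rightarrow> real \<Rightarrow> real ^ 'n" where
  "coag_frag_step x i j u =
     (\<chi> l. if l = i then u * (x $ i + x $ j)
           else if l = j then (1 - u) * (x $ i + x $ j)
           else x $ l)"

text \<open>The law of the next state given the current state \<open>x\<close>; the product measure makes the
  ordered pair and the uniform variable independent.\<close>

definition coag_frag_kernel :: "real ^ 'n \<Rightarrow> (real ^ 'n) measure" where
  "coag_frag_kernel x =
     distr (measure_pmf (pmf_of_set {(i, j). i \<noteq> j}) \<Otimes>\<^sub>M uniform_measure lborel {0..1}) borel
       (\<lambda>((i, j), u). coag_frag_step x i j u)"

definition past :: "'a measure \<Rightarrow> (nat \<Rightarrow> 'a \<Rightarrow> 's::topological_space) \<Rightarrow> nat \<Rightarrow> 'a measure" where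
  "past M X k = sigma (space M) {X l -` B \<inter> space M | l B. l \<le> k \<and> B \<in> sets borel}"

definition coag_frag_chain :: "'a measure \<Rightarrow> (nat \<Rightarrow> 'a \<Rightarrow> real ^ 'n) \<Rightarrow> bool" where
  "coag_frag_chain M X \<longleftrightarrow>
     prob_space M \<and>
     (\<forall>k. X k \<in> M \<rightarrow>\<^sub>M restrict_space borel std_simplex) \<and>
     (\<forall>k. \<forall>B \<in> sets borel. AE \<omega> in M.
        real_cond_exp M (past M X k) (indicator (X (Suc k) -` B \<inter> space M)) \<omega>
          = measure (coag_frag_kernel (X k \<omega>)) B)"

definition rescale :: "nat \<Rightarrow> nat ^ 'n \<Rightarrow> real ^ 'n" where
  "rescale n v = (\<chi> i. real (v $ i) / real n)"

text \<open>Weak convergence of Borel probability measures on the subspace \<open>S\<close>, i.e. of measures on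
  \<open>restrict_space borel S\<close>; the integrals only see the values of the test function on \<open>S\<close>.\<close>

definition weak_conv_on :: "'s::topological_space set \<Rightarrow> (nat \<Rightarrow> 's measure) \<Rightarrow> 's measure \<Rightarrow> bool" where
  "weak_conv_on S \<mu> \<nu> \<longleftrightarrow>
     (\<forall>f :: 's \<Rightarrow> real. continuous_on S f \<and> bounded (f ` S) \<longrightarrow>
        (\<lambda>n. \<integral>x. f x \<partial>\<mu> n) \<longlonglongrightarrow> (\<integral>x. f x \<partial>\<nu>))"

end

theory Submission imports Defs begin

text \<open>
  Weak convergence is preserved by each step of the chains, because the transition operators
  converge uniformly and the limiting one is Feller; the claim follows by induction on time.

  Let \<open>T\<close> be the transition operator of the continuous-space chain and \<open>T\<^sub>n\<close> that of the discrete one.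
  After the pair \<open>(i, j)\<close> is drawn, the continuous chain splits the mass \<open>x $ i + x $ j\<close> at a uniform
  fraction \<open>u\<close>, and the discrete chain splits \<open>m = v $ i + v $ j\<close> units at a uniform element of
  \<open>{0..m}\<close>, which may be taken to be \<open>\<lfloor>u (m + 1)\<rfloor>\<close>. With this coupling the two successors of
  \<open>v / n\<close> differ by at most \<open>1 / n\<close> in each coordinate, whatever the state \<open>v\<close>. A continuous \<open>g\<close> is
  uniformly continuous on the compact simplex, so \<open>T\<^sub>n (g \<circ> rescale n)\<close> and \<open>T g \<circ> rescale n\<close> are
  uniformly close on the discrete simplex (\<open>discrete_operator_approximates\<close>).

  The Markov properties give \<open>E g(Y\<^sub>k\<^sub>+\<^sub>1) = E (T\<^sub>n (g \<circ> rescale n))(X\<^sub>k)\<close> for the discrete chain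
  (\<open>discrete_chain_expectation_Suc\<close>) and the corresponding identity with \<open>T\<close> for the limit chain
  (\<open>coag_frag_chain_expectation_Suc\<close>). Hence \<open>E g(Y\<^sub>k\<^sub>+\<^sub>1) = E (T g)(Y\<^sub>k) + o(1)\<close>, and since \<open>T g\<close> is again
  bounded and continuous (\<open>coag_frag_operator_continuous\<close>), convergence at time \<open>k\<close> gives convergence
  at time \<open>k + 1\<close>.
\<close>

section \<open>One step of the discrete chain\<close>

lemma finite_discrete_simplex: "finite (discrete_simplex n :: (nat ^ 'n) set)"
proof (rule finite_subset)
  show "(discrete_simplex n :: (nat ^ 'n) set) \<subseteq> vec_lambda ` (PiE UNIV (\<lambda>_. {..n}))"
  proof
    fix v :: "nat ^ 'n" assume "v \<in> discrete_simplex n"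
    then have "v $ i \<le> n" for i
      unfolding discrete_simplex_def using member_le_sum[of i UNIV "\<lambda>i. v $ i"] by auto
    then show "v \<in> vec_lambda ` (PiE UNIV (\<lambda>_. {..n}))"
      by (intro image_eqI[of _ _ "\<lambda>i. v $ i"]) auto
  qed
qed (simp add: finite_PiE)

lemma sum_split_pair:
  fixes f :: "'i :: finite \<Rightarrow> 'c :: comm_monoid_add"
  assumes "i \<noteq> j"
  shows "(\<Sum>l\<in>UNIV. f l) = f i + f j + (\<Sum>l\<in>UNIV - {i, j}. f l)"
proof -
  have "(\<Sum>l\<in>UNIV. f l) = (\<Sum>l\<in>UNIV - {i, j}. f l) + (\<Sum>l\<in>{i, j}. f l)"
    by (rule sum.subset_diff) auto
  then show ?thesis using assms by (simp add: add_ac)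
qed

definition discrete_step :: "nat ^ 'n \<Rightarrow> 'n \<Rightarrow> 'n \<Rightarrow> nat \<Rightarrow> nat ^ 'n" where
  "discrete_step v i j a =
     (\<chi> l. if l = i then a else if l = j then v $ i + v $ j - a else v $ l)"

text \<open>The transition operator of the discrete chain with the two Kronecker deltas resolved: after
  the pair is drawn, the new value of the first chosen coordinate is uniform on
  \<open>{0..v $ i + v $ j}\<close>.\<close>

definition discrete_operator :: "(nat ^ 'n \<Rightarrow> real) \<Rightarrow> nat ^ 'n \<Rightarrow> real" where
  "discrete_operator h v =
     (\<Sum>(i, j) \<in> {(i, j). i \<noteq> j}.
        (\<Sum>a\<le>v $ i + v $ j. h (discrete_step v i j a)) / real (v $ i + v $ j + 1))
     / (real CARD('n) * (real CARD('n) - 1))"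

lemma discrete_step_targets:
  fixes v :: "nat ^ 'n"
  assumes "i \<noteq> j" and v: "v \<in> discrete_simplex n"
  shows "bij_betw (discrete_step v i j) {..v $ i + v $ j}
     {w \<in> discrete_simplex n. v $ i + v $ j = w $ i + w $ j \<and> (\<forall>k \<in> UNIV - {i, j}. w $ k = v $ k)}"
proof -
  have total: "w \<in> discrete_simplex n \<longleftrightarrow> w $ i + w $ j + (\<Sum>l\<in>UNIV - {i, j}. w $ l) = n"
    for w :: "nat ^ 'n"
    unfolding discrete_simplex_def mem_Collect_eq sum_split_pair[OF \<open>i \<noteq> j\<close>] ..
  show ?thesis
  proof (rule bij_betw_byWitness[where f' = "\<lambda>w. w $ i"])
    show "\<forall>a\<in>{..v $ i + v $ j}. discrete_step v i j a $ i = a"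
      by (simp add: discrete_step_def)
    show "\<forall>w\<in>{w \<in> discrete_simplex n. v $ i + v $ j = w $ i + w $ j
        \<and> (\<forall>k \<in> UNIV - {i, j}. w $ k = v $ k)}. discrete_step v i j (w $ i) = w"
      by (auto simp: discrete_step_def vec_eq_iff)
    have "discrete_step v i j a \<in> discrete_simplex n" if "a \<le> v $ i + v $ j" for a
    proof -
      have "(\<Sum>l\<in>UNIV - {i, j}. discrete_step v i j a $ l) = (\<Sum>l\<in>UNIV - {i, j}. v $ l)"
        by (intro sum.cong) (auto simp: discrete_step_def)
      then show ?thesis
        using that v \<open>i \<noteq> j\<close> unfolding total by (simp add: discrete_step_def)
    qed
    then show "discrete_step v i j ` {..v $ i + v $ j} \<subseteq>
      {w \<in> discrete_simplex n. v $ i + v $ j = w $ i + w $ j \<and> (\<forall>k \<in> UNIV - {i, j}. w $ k = v $ k)}"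
      using \<open>i \<noteq> j\<close> by (auto simp: discrete_step_def split: if_splits)
  qed auto
qed

lemma discrete_step_in_simplex:
  fixes v :: "nat ^ 'n"
  assumes "i \<noteq> j" "v \<in> discrete_simplex n" "a \<le> v $ i + v $ j"
  shows "discrete_step v i j a \<in> discrete_simplex n"
  using bij_betwE[OF discrete_step_targets[OF assms(1,2)]] assms(3) by auto

text \<open>For a fixed pair, the deltas of the transition probability select the bijective image of
  \<open>{..v $ i + v $ j}\<close> under the step, so summing over all target states becomes averaging over
  the size of the first of the two new clusters.\<close>

lemma sum_discrete_trans:
  fixes v :: "nat ^ 'n"
  assumes v: "v \<in> discrete_simplex n"
  shows "(\<Sum>w\<in>discrete_simplex n. h w * discrete_trans v w) = discrete_operator h v"
proof -
  let ?P = "{(i, j). i \<noteq> j} :: ('n \<times> 'n) set"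
  let ?D = "discrete_simplex n :: (nat ^ 'n) set"
  let ?c = "1 / (real CARD('n) * (real CARD('n) - 1))"
  let ?R = "\<lambda>i j w. v $ i + v $ j = w $ i + w $ j \<and> (\<forall>k \<in> UNIV - {i, j}. w $ k = v $ k)"
  have trans: "discrete_trans v w
      = (\<Sum>(i, j)\<in>?P. ?c * (of_bool (?R i j w) / real (v $ i + v $ j + 1)))" for w
  proof -
    have prod: "(\<Prod>k\<in>UNIV - {i, j}. of_bool (w $ k = v $ k)) =
      (of_bool (\<forall>k\<in>UNIV - {i, j}. w $ k = v $ k) :: real)" for i j
      by (auto simp: prod.neutral)
    show ?thesis
      unfolding discrete_trans_def prod by (intro sum.cong refl) auto
  qed
  have "(\<Sum>w\<in>?D. h w * discrete_trans v w)
      = (\<Sum>w\<in>?D. \<Sum>(i, j)\<in>?P. ?c * (h w * of_bool (?R i j w) / real (v $ i + v $ j + 1)))"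
    unfolding trans sum_distrib_left by (intro sum.cong refl) (auto simp: field_simps)
  also have "\<dots> = (\<Sum>(i, j)\<in>?P. \<Sum>w\<in>?D. ?c * (h w * of_bool (?R i j w) / real (v $ i + v $ j + 1)))"
    by (subst sum.swap) (simp add: case_prod_unfold)
  also have "\<dots> = (\<Sum>(i, j)\<in>?P. ?c *
      ((\<Sum>a\<le>v $ i + v $ j. h (discrete_step v i j a)) / real (v $ i + v $ j + 1)))"
  proof (intro sum.cong refl, clarify)
    fix i j :: 'n assume "i \<noteq> j"
    have "(\<Sum>a\<le>v $ i + v $ j. h (discrete_step v i j a)) = (\<Sum>w\<in>{w\<in>?D. ?R i j w}. h w)"
      by (rule sum.reindex_bij_betw[OF discrete_step_targets[OF \<open>i \<noteq> j\<close> v]])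
    also have "\<dots> = (\<Sum>w\<in>?D. h w * of_bool (?R i j w))"
      by (simp add: sum.inter_filter finite_discrete_simplex of_bool_def if_distrib cong: if_cong)
    finally have "(\<Sum>a\<le>v $ i + v $ j. h (discrete_step v i j a)) = (\<Sum>w\<in>?D. h w * of_bool (?R i j w))" .
    then show "(\<Sum>w\<in>?D. ?c * (h w * of_bool (?R i j w) / real (v $ i + v $ j + 1))) = ?c *
      ((\<Sum>a\<le>v $ i + v $ j. h (discrete_step v i j a)) / real (v $ i + v $ j + 1))"
      by (simp only: sum_distrib_left sum_divide_distrib)
  qed
  also have "\<dots> = discrete_operator h v"
    unfolding discrete_operator_def by (simp add: case_prod_unfold sum_divide_distrib)
  finally show ?thesis .
qed

lemma (in finite_measure) integral_finite_range:
  fixes \<phi> :: "'c \<Rightarrow> real"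
  assumes W: "W \<in> M \<rightarrow>\<^sub>M count_space A" and "finite A"
  shows "(\<integral>\<omega>. \<phi> (W \<omega>) \<partial>M) = (\<Sum>a\<in>A. \<phi> a * measure M {\<omega> \<in> space M. W \<omega> = a})"
proof -
  have "(\<integral>\<omega>. \<phi> (W \<omega>) \<partial>M) = (\<integral>a. \<phi> a \<partial>distr M (count_space A) W)"
    by (rule integral_distr[OF W, symmetric]) simp
  also have "\<dots> = (\<integral>a. (\<Sum>b\<in>A. \<phi> b * indicator {b} a) \<partial>distr M (count_space A) W)"
    using \<open>finite A\<close> by (intro Bochner_Integration.integral_cong refl) (simp add: indicator_def if_distrib cong: if_cong)
  also have "\<dots> = (\<Sum>b\<in>A. \<phi> b * measure (distr M (count_space A) W) {b})"
    using finite_measure_distr[OF W]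
    by (subst Bochner_Integration.integral_sum)
       (auto intro!: integrable_mult_right simp: finite_measure.emeasure_finite less_top[symmetric])
  also have "\<dots> = (\<Sum>a\<in>A. \<phi> a * measure M {\<omega> \<in> space M. W \<omega> = a})"
    using W by (intro sum.cong refl) (auto simp: measure_distr vimage_def Int_def conj_commute)
  finally show ?thesis .
qed

text \<open>The Markov property is given through conditional probabilities on full histories
  \<open>X 0, \<dots>, X k\<close>. Only finitely many histories exist, so the expectation of a function of the
  next state is a finite sum over pairs of a history and a next state, and the transition
  probability can be pulled out history by history. Histories of probability zero contribute zero
  to both sides.\<close>

lemma discrete_chain_expectation_Suc:
  fixes X :: "nat \<Rightarrow> 'a \<Rightarrow> nat ^ 'n"
  assumes chain: "discrete_coag_frag_chain n M X"
  shows "(\<integral>\<omega>. h (X (Suc k) \<omega>) \<partial>M) = (\<integral>\<omega>. discrete_operator h (X k \<omega>) \<partial>M)"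
proof -
  let ?D = "discrete_simplex n :: (nat ^ 'n) set"
  let ?S = "PiE {..k} (\<lambda>_. ?D)"
  \<comment> \<open>Restriction to \<open>{..k}\<close> gives each history exactly one representative in the finite set \<open>?S\<close>.\<close>
  let ?path = "\<lambda>\<omega>. \<lambda>l\<in>{..k}. X l \<omega>"
  interpret prob_space M using chain by (simp add: discrete_coag_frag_chain_def)
  have X: "X l \<in> M \<rightarrow>\<^sub>M count_space ?D" for l
    using chain by (simp add: discrete_coag_frag_chain_def)
  have XD: "X l \<omega> \<in> ?D" if "\<omega> \<in> space M" for l \<omega>
    using measurable_space[OF X that] by simp
  have X_set [measurable]: "{\<omega> \<in> space M. X l \<omega> = v} \<in> sets M" for l v
  proof (cases "v \<in> ?D")
    case True
    then have "X l -` {v} \<inter> space M \<in> sets M" by (intro measurable_sets[OF X]) simp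
    then show ?thesis by (simp add: vimage_def Int_def conj_commute)
  next
    case False
    then have "{\<omega> \<in> space M. X l \<omega> = v} = {}" using XD by auto
    then show ?thesis by (simp only: sets.empty_sets)
  qed
  have finS: "finite ?S" by (simp add: finite_PiE finite_discrete_simplex)
  have path_eq: "?path \<omega> = s \<longleftrightarrow> (\<forall>l\<le>k. X l \<omega> = s l)" if "s \<in> ?S" for s \<omega>
    using that by (auto simp: fun_eq_iff PiE_iff extensional_def restrict_def)
  have path_set [measurable]: "{\<omega> \<in> space M. \<forall>l\<le>k. X l \<omega> = s l} \<in> sets M" for s
    by measurable
  have path_meas: "?path \<in> M \<rightarrow>\<^sub>M count_space ?S"
  proof (subst measurable_count_space_eq2[OF finS], intro conjI ballI)
    show "?path \<in> space M \<rightarrow> ?S" using XD by auto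
    fix s assume "s \<in> ?S"
    then have "?path -` {s} \<inter> space M = {\<omega> \<in> space M. \<forall>l\<le>k. X l \<omega> = s l}"
      using path_eq by auto
    then show "?path -` {s} \<inter> space M \<in> sets M" by simp
  qed
  have joint_meas: "(\<lambda>\<omega>. (?path \<omega>, X (Suc k) \<omega>)) \<in> M \<rightarrow>\<^sub>M count_space (?S \<times> ?D)"
  proof (subst measurable_count_space_eq2, goal_cases)
    case 1 show ?case using finS finite_discrete_simplex by auto
  next
    case 2
    have "(\<lambda>\<omega>. (?path \<omega>, X (Suc k) \<omega>)) -` {(s, w)} \<inter> space M
        = {\<omega> \<in> space M. \<forall>l\<le>k. X l \<omega> = s l} \<inter> {\<omega> \<in> space M. X (Suc k) \<omega> = w}"
      if "s \<in> ?S" for s w using path_eq[OF that] by auto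
    then show ?case using XD by auto
  qed
  have step: "prob {\<omega> \<in> space M. (?path \<omega>, X (Suc k) \<omega>) = (s, w)}
      = prob {\<omega> \<in> space M. ?path \<omega> = s} * discrete_trans (s k) w" if s: "s \<in> ?S" and w: "w \<in> ?D" for s w
  proof -
    let ?B = "{\<omega> \<in> space M. \<forall>l\<le>k. X l \<omega> = s l}"
    have A: "{\<omega> \<in> space M. (?path \<omega>, X (Suc k) \<omega>) = (s, w)}
        = {\<omega> \<in> space M. X (Suc k) \<omega> = w \<and> (\<forall>l\<le>k. X l \<omega> = s l)}"
      and B: "{\<omega> \<in> space M. ?path \<omega> = s} = ?B"
      using path_eq[OF s] by auto
    show ?thesis
    proof (cases "prob ?B = 0")
      case True
      have "prob {\<omega> \<in> space M. X (Suc k) \<omega> = w \<and> (\<forall>l\<le>k. X l \<omega> = s l)} \<le> prob ?B"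
        by (intro finite_measure_mono) auto
      with True show ?thesis unfolding A B by (simp add: measure_le_0_iff)
    next
      case False
      then have "\<P>(\<omega> in M. X (Suc k) \<omega> = w \<bar> \<forall>l\<le>k. X l \<omega> = s l) = discrete_trans (s k) w"
        using chain w by (auto simp: discrete_coag_frag_chain_def)
      with False show ?thesis unfolding A B by (simp add: cond_prob_def field_simps)
    qed
  qed
  have "(\<integral>\<omega>. h (X (Suc k) \<omega>) \<partial>M) = (\<integral>\<omega>. (\<lambda>(s, w). h w) (?path \<omega>, X (Suc k) \<omega>) \<partial>M)"
    by simp
  also have "\<dots> = (\<Sum>(s, w)\<in>?S \<times> ?D. h w * prob {\<omega> \<in> space M. (?path \<omega>, X (Suc k) \<omega>) = (s, w)})"
    by (subst integral_finite_range[OF joint_meas]) (use finS finite_discrete_simplex in \<open>auto simp: case_prod_unfold prod_eq_iff\<close>)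
  also have "\<dots> = (\<Sum>(s, w)\<in>?S \<times> ?D. h w * (prob {\<omega> \<in> space M. ?path \<omega> = s} * discrete_trans (s k) w))"
    by (intro sum.cong refl) (use step in auto)
  also have "\<dots> = (\<Sum>s\<in>?S. prob {\<omega> \<in> space M. ?path \<omega> = s} * (\<Sum>w\<in>?D. h w * discrete_trans (s k) w))"
    unfolding sum.cartesian_product[symmetric] sum_distrib_left
    by (intro sum.cong refl) (simp only: mult_ac)
  also have "\<dots> = (\<Sum>s\<in>?S. discrete_operator h (s k) * prob {\<omega> \<in> space M. ?path \<omega> = s})"
    by (intro sum.cong refl) (auto simp: sum_discrete_trans PiE_iff)
  also have "\<dots> = (\<integral>\<omega>. discrete_operator h (?path \<omega> k) \<partial>M)"
    by (rule integral_finite_range[OF path_meas finS, symmetric])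
  finally show ?thesis by simp
qed

section \<open>One step of the continuous-space chain\<close>

definition coag_frag_operator :: "(real ^ 'n \<Rightarrow> real) \<Rightarrow> real ^ 'n \<Rightarrow> real" where
  "coag_frag_operator g x =
     (\<Sum>(i, j) \<in> {(i, j). i \<noteq> j}. \<integral>u. g (coag_frag_step x i j u) \<partial>uniform_measure lborel {0..1})
     / (real CARD('n) * (real CARD('n) - 1))"

lemma card_distinct_pairs:
  "real (card {(i, j). i \<noteq> (j :: 'n :: finite)}) = real CARD('n) * (real CARD('n) - 1)"
proof -
  have "{(i, j). i \<noteq> (j :: 'n)} = Sigma UNIV (\<lambda>i. UNIV - {i})" by auto
  then have "card {(i, j). i \<noteq> (j :: 'n)} = CARD('n) * (CARD('n) - 1)"
    by (simp add: card_SigmaI card_Diff_singleton)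
  then show ?thesis by (simp add: of_nat_diff Suc_leI)
qed

lemma distinct_pairs_nonempty:
  assumes "CARD('n :: finite) \<ge> 2"
  shows "{(i, j). i \<noteq> (j :: 'n)} \<noteq> {}"
proof -
  have "real (card {(i, j). i \<noteq> (j :: 'n)}) \<noteq> 0"
    unfolding card_distinct_pairs using assms by simp
  then show ?thesis by (metis card.empty of_nat_0)
qed

lemma prob_space_uniform_01: "prob_space (uniform_measure lborel {0..1 :: real})"
  by (rule prob_space_uniform_measure) auto

lemma continuous_coag_frag_step:
  "continuous_on UNIV (\<lambda>(x :: real ^ 'n, u). coag_frag_step x i j u)"
proof -
  have "continuous_on UNIV (\<lambda>p. coag_frag_step (fst p :: real ^ 'n) i j (snd p) $ l)" for l
    unfolding coag_frag_step_def
    by (cases "l = i"; cases "l = j") (auto intro!: continuous_intros)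
  then have "continuous_on UNIV (\<lambda>p. \<chi> l. coag_frag_step (fst p :: real ^ 'n) i j (snd p) $ l)"
    by (rule continuous_on_vec_lambda)
  then show ?thesis by (simp add: case_prod_unfold)
qed

text \<open>There are finitely many pairs of indices, so joint measurability reduces to a fixed pair, for
  which the step is jointly continuous in the state and the uniform variable.\<close>

lemma measurable_coag_frag_step [measurable]:
  assumes "f \<in> borel_measurable M" "p \<in> M \<rightarrow>\<^sub>M count_space UNIV" "u \<in> borel_measurable M"
  shows "(\<lambda>\<omega>. coag_frag_step (f \<omega> :: real ^ 'n) (fst (p \<omega>)) (snd (p \<omega>)) (u \<omega>)) \<in> borel_measurable M"
proof (rule measurable_compose_countable[OF _ assms(2)])
  fix q :: "'n \<times> 'n"
  have "(\<lambda>(x :: real ^ 'n, u). coag_frag_step x (fst q) (snd q) u) \<in> borel_measurable (borel \<Otimes>\<^sub>M borel)"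
    unfolding borel_prod by (rule borel_measurable_continuous_onI[OF continuous_coag_frag_step])
  moreover have "(\<lambda>\<omega>. (f \<omega>, u \<omega>)) \<in> M \<rightarrow>\<^sub>M borel \<Otimes>\<^sub>M borel"
    using assms by measurable
  ultimately show "(\<lambda>\<omega>. coag_frag_step (f \<omega>) (fst q) (snd q) (u \<omega>)) \<in> borel_measurable M"
    by (auto dest: measurable_compose[rotated])
qed

lemma measurable_pair_choice: "fst \<in> measure_pmf p \<Otimes>\<^sub>M Q \<rightarrow>\<^sub>M count_space UNIV"
  by (subst measurable_cong_sets[OF refl sets_measure_pmf_count_space[of p, symmetric]])
     (rule measurable_fst)

lemma measurable_uniform_choice: "snd \<in> P \<Otimes>\<^sub>M uniform_measure lborel A \<rightarrow>\<^sub>M borel"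
proof -
  have "sets borel = sets (uniform_measure lborel A)" by simp
  from measurable_cong_sets[OF refl this] show ?thesis using measurable_snd by blast
qed

lemma coag_frag_kernel_measurable:
  "(coag_frag_kernel :: real ^ 'n \<Rightarrow> _) \<in> borel \<rightarrow>\<^sub>M prob_algebra borel"
proof -
  let ?Q = "measure_pmf (pmf_of_set {(i, j). i \<noteq> (j :: 'n)}) \<Otimes>\<^sub>M uniform_measure lborel {0..1 :: real}"
  interpret P: pair_prob_space "measure_pmf (pmf_of_set {(i, j). i \<noteq> (j :: 'n)})"
      "uniform_measure lborel {0..1 :: real}"
    by (intro pair_prob_space.intro pair_sigma_finite.intro prob_space_imp_sigma_finite
          measure_pmf.prob_space_axioms prob_space_uniform_01)
  have step: "(\<lambda>(x, ((i, j), u)). coag_frag_step x i j u) \<in> borel \<Otimes>\<^sub>M ?Q \<rightarrow>\<^sub>M (borel :: (real ^ 'n) measure)"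
  proof -
    note measurable_pair_choice [measurable] and measurable_uniform_choice [measurable]
    show ?thesis
      unfolding case_prod_unfold by measurable
  qed
  have const: "(\<lambda>_. ?Q) \<in> (borel :: (real ^ 'n) measure) \<rightarrow>\<^sub>M prob_algebra ?Q"
    by (rule measurable_const) (simp add: space_prob_algebra P.prob_space_axioms)
  show ?thesis
    unfolding coag_frag_kernel_def using measurable_distr_prob_space2[OF const step] by simp
qed

lemma prob_space_coag_frag_kernel: "prob_space (coag_frag_kernel (x :: real ^ 'n))"
  and sets_coag_frag_kernel: "sets (coag_frag_kernel (x :: real ^ 'n)) = sets borel"
  using measurable_space[OF coag_frag_kernel_measurable, of x]
  by (auto simp: space_prob_algebra)

text \<open>Fubini separates the choice of the pair from the uniform variable. This identifies the
  explicit average of one-dimensional integrals, which can be compared with Riemann sums, with the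
  transition operator of the kernel.\<close>

lemma integral_coag_frag_kernel:
  fixes g :: "real ^ 'n \<Rightarrow> real"
  assumes N: "CARD('n) \<ge> 2" and g [measurable]: "g \<in> borel_measurable borel" and bound: "\<And>x. \<bar>g x\<bar> \<le> B"
  shows "(\<integral>y. g y \<partial>coag_frag_kernel x) = coag_frag_operator g x"
proof -
  let ?P = "{(i, j). i \<noteq> (j :: 'n)}" and ?U = "uniform_measure lborel {0..1 :: real}"
  let ?p = "measure_pmf (pmf_of_set ?P)"
  interpret P: pair_prob_space ?p ?U
    by (intro pair_prob_space.intro pair_sigma_finite.intro prob_space_imp_sigma_finite
          measure_pmf.prob_space_axioms prob_space_uniform_01)
  have step [measurable]: "(\<lambda>q. coag_frag_step x (fst (fst q)) (snd (fst q)) (snd q)) \<in> borel_measurable (?p \<Otimes>\<^sub>M ?U)"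
  proof -
    note measurable_pair_choice [measurable] and measurable_uniform_choice [measurable]
    show ?thesis by measurable
  qed
  let ?f = "\<lambda>q. g (coag_frag_step x (fst (fst q)) (snd (fst q)) (snd q))"
  have int: "integrable (?p \<Otimes>\<^sub>M ?U) ?f"
    by (rule P.integrable_const_bound[where B = B]) (auto simp: bound)
  have "(\<integral>y. g y \<partial>coag_frag_kernel x) = (\<integral>q. ?f q \<partial>(?p \<Otimes>\<^sub>M ?U))"
    using integral_distr[OF step g] unfolding coag_frag_kernel_def case_prod_unfold .
  also have "\<dots> = (\<integral>p. (\<integral>u. ?f (p, u) \<partial>?U) \<partial>?p)"
    by (rule P.integral_fst'[OF int, symmetric])
  also have "\<dots> = (\<Sum>p\<in>?P. \<integral>u. ?f (p, u) \<partial>?U) / real (card ?P)"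
    by (rule integral_pmf_of_set[OF distinct_pairs_nonempty[OF N]]) simp
  also have "\<dots> = coag_frag_operator g x"
    unfolding coag_frag_operator_def card_distinct_pairs by (simp add: case_prod_unfold)
  finally show ?thesis .
qed

lemma subalgebra_past:
  assumes "\<And>l. X l \<in> borel_measurable M"
  shows "subalgebra M (past M X k)"
proof -
  have gen: "{X l -` B \<inter> space M |l B. l \<le> k \<and> B \<in> sets borel} \<subseteq> Pow (space M)" by auto
  have "sets (past M X k) \<subseteq> sets M"
    unfolding past_def sets_measure_of[OF gen]
    by (intro sets.sigma_sets_subset) (auto intro: measurable_sets[OF assms])
  then show ?thesis by (simp add: subalgebra_def past_def space_measure_of[OF gen])
qed

lemma coag_frag_chain_borel:
  assumes "coag_frag_chain M X"
  shows "X l \<in> borel_measurable M"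
  using assms by (auto simp: coag_frag_chain_def measurable_restrict_space2_iff)

text \<open>Taking expectations in the Markov property for the event that the next state lies in \<open>B\<close>
  removes the conditional expectation and leaves the Chapman-Kolmogorov equation for the laws.\<close>

lemma coag_frag_chain_law_Suc:
  fixes X :: "nat \<Rightarrow> 'a \<Rightarrow> real ^ 'n"
  assumes chain: "coag_frag_chain M X"
  shows "distr M borel (X (Suc k)) = distr M borel (X k) \<bind> coag_frag_kernel"
proof (rule measure_eqI)
  interpret prob_space M using chain by (simp add: coag_frag_chain_def)
  note X [measurable] = coag_frag_chain_borel[OF chain]
  note K [measurable] = measurable_prob_algebraD[OF coag_frag_kernel_measurable]
  interpret F: finite_measure_subalgebra M "past M X k"
    by (unfold_locales) (rule subalgebra_past[OF X])
  show "sets (distr M borel (X (Suc k))) = sets (distr M borel (X k) \<bind> coag_frag_kernel)"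
    by (subst sets_bind[where N = borel]) (auto simp: sets_coag_frag_kernel)
  fix B assume "B \<in> sets (distr M borel (X (Suc k)))"
  then have B [measurable]: "B \<in> sets borel" by simp
  have "(\<integral>\<omega>. measure (coag_frag_kernel (X k \<omega>)) B \<partial>M)
      = (\<integral>\<omega>. real_cond_exp M (past M X k) (indicator (X (Suc k) -` B \<inter> space M)) \<omega> \<partial>M)"
  proof (rule integral_cong_AE)
    have "AE \<omega> in M. real_cond_exp M (past M X k) (indicator (X (Suc k) -` B \<inter> space M)) \<omega>
        = measure (coag_frag_kernel (X k \<omega>)) B"
      using chain B by (simp add: coag_frag_chain_def)
    then show "AE \<omega> in M. measure (coag_frag_kernel (X k \<omega>)) B
        = real_cond_exp M (past M X k) (indicator (X (Suc k) -` B \<inter> space M)) \<omega>"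
      by eventually_elim simp
  qed auto
  also have "\<dots> = measure M (X (Suc k) -` B \<inter> space M)"
    by (subst F.real_cond_exp_int(2)) (auto intro!: integrable_real_indicator simp: emeasure_eq_measure)
  finally have *: "measure M (X (Suc k) -` B \<inter> space M) = (\<integral>\<omega>. measure (coag_frag_kernel (X k \<omega>)) B \<partial>M)" ..
  have "emeasure (distr M borel (X k) \<bind> coag_frag_kernel) B
      = (\<integral>\<^sup>+\<omega>. emeasure (coag_frag_kernel (X k \<omega>)) B \<partial>M)"
    by (subst emeasure_bind[where N = borel]) (auto simp: nn_integral_distr)
  also have "\<dots> = (\<integral>\<^sup>+\<omega>. ennreal (measure (coag_frag_kernel (X k \<omega>)) B) \<partial>M)"
    by (intro nn_integral_cong)
       (simp add: finite_measure.emeasure_eq_measure prob_space.finite_measure prob_space_coag_frag_kernel)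
  also have "\<dots> = ennreal (\<integral>\<omega>. measure (coag_frag_kernel (X k \<omega>)) B \<partial>M)"
    by (intro nn_integral_eq_integral integrable_const_bound[where B = 1])
       (auto simp: prob_space.prob_le_1 prob_space_coag_frag_kernel)
  finally show "emeasure (distr M borel (X (Suc k))) B = emeasure (distr M borel (X k) \<bind> coag_frag_kernel) B"
    by (simp add: emeasure_distr emeasure_eq_measure *)
qed

lemma coag_frag_chain_expectation_Suc:
  fixes X :: "nat \<Rightarrow> 'a \<Rightarrow> real ^ 'n" and g :: "real ^ 'n \<Rightarrow> real"
  assumes chain: "coag_frag_chain M X" and N: "CARD('n) \<ge> 2"
    and g [measurable]: "g \<in> borel_measurable borel" and bound: "\<And>x. \<bar>g x\<bar> \<le> B"
  shows "(\<integral>\<omega>. g (X (Suc k) \<omega>) \<partial>M) = (\<integral>\<omega>. coag_frag_operator g (X k \<omega>) \<partial>M)"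
proof -
  interpret prob_space M using chain by (simp add: coag_frag_chain_def)
  note X [measurable] = coag_frag_chain_borel[OF chain]
  note K [measurable] = measurable_prob_algebraD[OF coag_frag_kernel_measurable]
  have op: "coag_frag_operator g = (\<lambda>x. \<integral>y. g y \<partial>coag_frag_kernel x)"
    using integral_coag_frag_kernel[OF N g bound] by auto
  have "(\<integral>\<omega>. g (X (Suc k) \<omega>) \<partial>M) = (\<integral>y. g y \<partial>(distr M borel (X k) \<bind> coag_frag_kernel))"
    unfolding coag_frag_chain_law_Suc[OF chain, symmetric] by (simp add: integral_distr)
  also have "\<dots> = (\<integral>x. coag_frag_operator g x \<partial>distr M borel (X k))"
    unfolding op using bound
    by (intro integral_bind[where K = borel and B = B and B' = 1])
       (auto simp: finite_measure_distr prob_space.emeasure_space_1[OF prob_space_coag_frag_kernel])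
  also have "\<dots> = (\<integral>\<omega>. coag_frag_operator g (X k \<omega>) \<partial>M)"
    unfolding op
    by (intro integral_distr X measurable_compose[OF K integral_measurable_subprob_algebra[OF g]])
  finally show ?thesis .
qed

section \<open>Uniform convergence of the transition operators\<close>

text \<open>With \<open>u\<close> uniform on the unit interval, \<open>a = \<lfloor>u (m + 1)\<rfloor>\<close> is uniform on \<open>{0..m}\<close>. The average
  of \<open>G\<close> is therefore the integral of a step function on \<open>m + 1\<close> cells of equal length, and it is
  enough to compare \<open>F\<close> and \<open>G\<close> cell by cell.\<close>

lemma Riemann_sum_error:
  fixes F :: "real \<Rightarrow> real"
  assumes F [measurable]: "F \<in> borel_measurable borel" and bound: "\<And>u. \<bar>F u\<bar> \<le> B"
    and close: "\<And>a u. a \<le> m \<Longrightarrow> 0 \<le> u \<Longrightarrow> u \<le> 1 \<Longrightarrow> real a \<le> u * real (m + 1) \<Longrightarrow> u * real (m + 1) \<le> real a + 1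
       \<Longrightarrow> \<bar>F u - G a\<bar> \<le> \<epsilon>"
  shows "\<bar>(\<integral>u. F u \<partial>uniform_measure lborel {0..1}) - (\<Sum>a\<le>m. G a) / real (m + 1)\<bar> \<le> \<epsilon>"
proof -
  let ?U = "uniform_measure lborel {0..1 :: real}"
  interpret U: prob_space ?U by (rule prob_space_uniform_01)
  define I where "I a = {real a / real (m + 1) ..< (real a + 1) / real (m + 1)}" for a
  have I_iff: "u \<in> I a \<longleftrightarrow> real a \<le> u * real (m + 1) \<and> u * real (m + 1) < real a + 1" for u a
    by (auto simp: I_def field_simps)
  have I_sets [measurable]: "I a \<in> sets borel" for a by (simp add: I_def)
  have I_prob: "measure ?U (I a) = 1 / real (m + 1)" if "a \<le> m" for a
  proof -
    have "(real a + 1) / real (m + 1) \<le> 1"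
      using that by (simp add: field_simps)
    moreover have "0 \<le> real a / real (m + 1)" by simp
    ultimately have "u \<in> {0..1}" if "u \<in> I a" for u
      using that unfolding I_def atLeastLessThan_iff atLeastAtMost_iff by linarith
    then have "{0..1} \<inter> I a = I a" by blast
    then have "measure ?U (I a) = measure lborel (I a)"
      by (subst measure_uniform_measure) auto
    also have "\<dots> = 1 / real (m + 1)"
      by (simp add: I_def divide_right_mono field_simps)
    finally show ?thesis .
  qed
  let ?G = "\<lambda>u. \<Sum>a\<le>m. G a * indicator (I a) u"
  have intI: "integrable ?U (\<lambda>u. G a * indicator (I a) u)" for a
    by (intro integrable_mult_right integrable_real_indicator) (auto simp: U.emeasure_eq_measure)
  have cell_integral: "(\<integral>u. G a * indicator (I a) u \<partial>?U) = G a / real (m + 1)" if "a \<le> m" for a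
  proof -
    have "(\<integral>u. G a * indicator (I a) u \<partial>?U) = G a * measure ?U (I a)"
      by (subst integral_mult_right_zero, subst Bochner_Integration.integral_indicator) simp_all
    then show ?thesis unfolding I_prob[OF that] by simp
  qed
  have intG: "integrable ?U ?G"
    by (intro Bochner_Integration.integrable_sum intI)
  have "(\<integral>u. ?G u \<partial>?U) = (\<Sum>a\<le>m. \<integral>u. G a * indicator (I a) u \<partial>?U)"
    by (rule Bochner_Integration.integral_sum) (rule intI)
  also have "\<dots> = (\<Sum>a\<le>m. G a) / real (m + 1)"
    unfolding sum_divide_distrib by (rule sum.cong[OF refl]) (rule cell_integral, unfold atMost_iff)
  finally have G: "(\<integral>u. ?G u \<partial>?U) = (\<Sum>a\<le>m. G a) / real (m + 1)" .
  have intF: "integrable ?U F"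
    by (rule U.integrable_const_bound[where B = B]) (auto simp: bound)
  have "AE u in ?U. 0 \<le> u \<and> u < 1"
  proof (rule AE_uniform_measureI)
    show "AE u in lborel. u \<in> {0..1} \<longrightarrow> 0 \<le> u \<and> u < (1 :: real)"
      using AE_lborel_singleton[of "1 :: real"] by eventually_elim auto
  qed simp
  then have close_AE: "AE u in ?U. \<bar>F u - ?G u\<bar> \<le> \<epsilon>"
  proof eventually_elim
    case (elim u)
    define a where "a = nat \<lfloor>u * real (m + 1)\<rfloor>"
    have a: "real a \<le> u * real (m + 1)" "u * real (m + 1) < real a + 1"
      unfolding a_def using elim by (auto simp: of_nat_nat mult_nonneg_nonneg zero_le_floor)
    have "u * real (m + 1) < real (m + 1)" using elim by simp
    with a(1) have "a \<le> m" by linarith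
    have ind: "indicator (I b) u = (of_bool (b = a) :: real)" for b
    proof -
      have "b = a" if "u \<in> I b" using that a unfolding I_iff by linarith
      moreover have "u \<in> I a" using a unfolding I_iff by blast
      ultimately have "u \<in> I b \<longleftrightarrow> b = a" by blast
      then show ?thesis unfolding indicator_def by (rule arg_cong)
    qed
    have "?G u = (\<Sum>b\<le>m. if b = a then G b else 0)"
      unfolding ind by (rule sum.cong) auto
    also have "\<dots> = G a" using \<open>a \<le> m\<close> by simp
    finally have G_u: "?G u = G a" .
    have "\<bar>F u - G a\<bar> \<le> \<epsilon>"
      by (rule close[OF \<open>a \<le> m\<close>]) (use a elim in \<open>simp_all only: less_imp_le\<close>)
    then show ?case unfolding G_u .
  qed
  have "\<bar>(\<integral>u. F u \<partial>?U) - (\<integral>u. ?G u \<partial>?U)\<bar> = \<bar>\<integral>u. F u - ?G u \<partial>?U\<bar>"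
    using intF intG by simp
  also have "\<dots> \<le> (\<integral>u. \<bar>F u - ?G u\<bar> \<partial>?U)"
    by (rule integral_abs_bound)
  also have "\<dots> \<le> (\<integral>u. \<epsilon> \<partial>?U)"
    using intF intG close_AE by (intro integral_mono_AE) auto
  also have "\<dots> = \<epsilon>" by (simp add: U.prob_space)
  finally show ?thesis unfolding G .
qed

lemma std_simplex_coord_le_1: "x \<in> std_simplex \<Longrightarrow> x $ i \<le> 1"
  unfolding std_simplex_def using member_le_sum[of i UNIV "\<lambda>i. x $ i"] by auto

lemma compact_std_simplex: "compact (std_simplex :: (real ^ 'n) set)"
proof (rule compact_eq_bounded_closed[THEN iffD2], intro conjI)
  have "std_simplex \<subseteq> cbox (0 :: real ^ 'n) (\<chi> i. 1)"
    by (auto simp: mem_box_cart std_simplex_coord_le_1) (simp add: std_simplex_def)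
  then show "bounded (std_simplex :: (real ^ 'n) set)"
    by (rule bounded_subset[OF bounded_cbox])
  show "closed (std_simplex :: (real ^ 'n) set)"
    unfolding std_simplex_def
    by (intro closed_Collect_conj closed_Collect_all closed_Collect_le closed_Collect_eq continuous_intros)
qed

lemma rescale_in_std_simplex:
  assumes "v \<in> discrete_simplex n" "n \<ge> 1"
  shows "rescale n v \<in> std_simplex"
proof -
  have "real (\<Sum>i\<in>UNIV. v $ i) = real n" using assms(1) by (simp add: discrete_simplex_def)
  then show ?thesis
    using assms(2) by (simp add: std_simplex_def rescale_def sum_divide_distrib[symmetric])
qed

lemma coag_frag_step_in_std_simplex:
  fixes x :: "real ^ 'n"
  assumes x: "x \<in> std_simplex" and "i \<noteq> j" "0 \<le> u" "u \<le> 1"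
  shows "coag_frag_step x i j u \<in> std_simplex"
proof -
  have pos: "0 \<le> x $ l" for l using x by (simp add: std_simplex_def)
  have "(\<Sum>l\<in>UNIV - {i, j}. coag_frag_step x i j u $ l) = (\<Sum>l\<in>UNIV - {i, j}. x $ l)"
    by (intro sum.cong) (auto simp: coag_frag_step_def)
  then have "(\<Sum>l\<in>UNIV. coag_frag_step x i j u $ l) = (\<Sum>l\<in>UNIV. x $ l)"
    unfolding sum_split_pair[OF \<open>i \<noteq> j\<close>] using \<open>i \<noteq> j\<close> by (simp add: coag_frag_step_def algebra_simps)
  then show ?thesis
    using x pos assms(3,4) by (auto simp: std_simplex_def coag_frag_step_def)
qed

text \<open>Write \<open>m = v $ i + v $ j\<close>. If \<open>u (m + 1)\<close> lies in \<open>[a, a + 1]\<close>, then \<open>u m - a\<close> lies in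
  \<open>[- u, 1 - u]\<close>, so every coordinate of the two new states differs by at most \<open>1 / n\<close>. The bound is
  uniform in the state; in particular \<open>m\<close> need not be large, which is what makes the approximation
  of the operators uniform.\<close>

lemma dist_coag_frag_step_rescale:
  fixes v :: "nat ^ 'n"
  assumes "i \<noteq> j" "n \<ge> 1" and a: "a \<le> v $ i + v $ j" and u: "0 \<le> u" "u \<le> 1"
    and cell: "real a \<le> u * real (v $ i + v $ j + 1)" "u * real (v $ i + v $ j + 1) \<le> real a + 1"
  shows "dist (coag_frag_step (rescale n v) i j u) (rescale n (discrete_step v i j a)) \<le> real CARD('n) / real n"
proof -
  let ?d = "coag_frag_step (rescale n v) i j u - rescale n (discrete_step v i j a)"
  let ?m = "v $ i + v $ j"
  have m: "\<bar>u * real ?m - real a\<bar> \<le> 1"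
    using cell u by (simp add: algebra_simps abs_le_iff)
  have "\<bar>?d $ l\<bar> \<le> 1 / real n" for l
  proof -
    consider "l = i" | "l = j" | "l \<noteq> i" "l \<noteq> j" by blast
    then show ?thesis
    proof cases
      case 1
      then have "?d $ l = (u * real ?m - real a) / real n"
        by (simp add: coag_frag_step_def rescale_def discrete_step_def algebra_simps add_divide_distrib diff_divide_distrib)
      then show ?thesis using m assms(2) by (simp add: divide_right_mono)
    next
      case 2
      then have "?d $ l = - (u * real ?m - real a) / real n"
        using \<open>i \<noteq> j\<close> a
        by (simp add: coag_frag_step_def rescale_def discrete_step_def of_nat_diff algebra_simps add_divide_distrib diff_divide_distrib)
      then show ?thesis using m assms(2) by (simp add: divide_right_mono abs_minus_commute)
    next
      case 3
      then show ?thesis by (simp add: coag_frag_step_def rescale_def discrete_step_def)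
    qed
  qed
  then have "(\<Sum>l\<in>UNIV. \<bar>?d $ l\<bar>) \<le> (\<Sum>l\<in>(UNIV :: 'n set). 1 / real n)" by (rule sum_mono)
  moreover have "norm ?d \<le> (\<Sum>l\<in>UNIV. \<bar>?d $ l\<bar>)" by (rule norm_le_l1_cart)
  ultimately show ?thesis by (simp add: dist_norm)
qed

lemma continuous_test_of_step:
  fixes g :: "real ^ 'n \<Rightarrow> real"
  assumes "continuous_on UNIV g"
  shows "continuous_on UNIV (\<lambda>u. g (coag_frag_step x i j u))"
proof -
  have "continuous_on UNIV (\<lambda>u :: real. (x, u))"
    by (intro continuous_on_Pair continuous_on_const continuous_on_id)
  from continuous_on_compose2[OF continuous_coag_frag_step[of i j] this]
  have "continuous_on UNIV (coag_frag_step x i j)" by simp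
  from continuous_on_compose2[OF assms this] show ?thesis by simp
qed

text \<open>The one-step operators converge uniformly over the states: coupling the two chains through
  the same pair and the same \<open>u\<close> puts the new states within \<open>O(1/n)\<close> of each other, and the test
  function is uniformly continuous on the compact simplex.\<close>

lemma discrete_operator_approximates:
  fixes g :: "real ^ 'n \<Rightarrow> real"
  assumes N: "CARD('n) \<ge> 2" and g: "continuous_on UNIV g" and bound: "\<And>x. \<bar>g x\<bar> \<le> B" and "\<epsilon> > 0"
  shows "\<forall>\<^sub>F n in sequentially. \<forall>v\<in>discrete_simplex n.
     \<bar>discrete_operator (\<lambda>w. g (rescale n w)) v - coag_frag_operator g (rescale n v)\<bar> \<le> \<epsilon>"
proof -
  let ?U = "uniform_measure lborel {0..1 :: real}" and ?P = "{(i, j). i \<noteq> (j :: 'n)}"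
  let ?N = "real CARD('n) * (real CARD('n) - 1)"
  have "uniformly_continuous_on std_simplex g"
    by (intro compact_uniformly_continuous continuous_on_subset[OF g] compact_std_simplex) auto
  then obtain \<delta> where "\<delta> > 0"
    and \<delta>: "\<And>x y. x \<in> std_simplex \<Longrightarrow> y \<in> std_simplex \<Longrightarrow> dist x y < \<delta> \<Longrightarrow> dist (g x) (g y) < \<epsilon>"
    using \<open>\<epsilon> > 0\<close> unfolding uniformly_continuous_on_def by metis
  have "(\<lambda>n. real CARD('n) / real n) \<longlonglongrightarrow> 0" by (rule lim_const_over_n)
  then have "\<forall>\<^sub>F n in sequentially. real CARD('n) / real n < \<delta>"
    using \<open>\<delta> > 0\<close> by (rule order_tendstoD)
  with eventually_ge_at_top[of 1] show ?thesis
  proof eventually_elim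
    case (elim n)
    show ?case
    proof
      fix v :: "nat ^ 'n" assume v: "v \<in> discrete_simplex n"
      let ?A = "\<lambda>i j. (\<Sum>a\<le>v $ i + v $ j. g (rescale n (discrete_step v i j a))) / real (v $ i + v $ j + 1)"
      let ?B = "\<lambda>i j. \<integral>u. g (coag_frag_step (rescale n v) i j u) \<partial>?U"
      have pair: "\<bar>?B i j - ?A i j\<bar> \<le> \<epsilon>" if "i \<noteq> j" for i j
      proof (rule Riemann_sum_error[where B = B])
        have "continuous_on UNIV (\<lambda>u. g (coag_frag_step (rescale n v) i j u))"
          by (rule continuous_test_of_step[OF g])
        then show "(\<lambda>u. g (coag_frag_step (rescale n v) i j u)) \<in> borel_measurable borel"
          by (rule borel_measurable_continuous_onI)
        show "\<bar>g (coag_frag_step (rescale n v) i j u)\<bar> \<le> B" for u by (rule bound)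
        fix a u assume a: "a \<le> v $ i + v $ j" "0 \<le> u" "u \<le> 1"
          "real a \<le> u * real (v $ i + v $ j + 1)" "u * real (v $ i + v $ j + 1) \<le> real a + 1"
        have "dist (g (coag_frag_step (rescale n v) i j u)) (g (rescale n (discrete_step v i j a))) < \<epsilon>"
        proof (rule \<delta>)
          show "coag_frag_step (rescale n v) i j u \<in> std_simplex"
            using rescale_in_std_simplex[OF v elim(1)] that a by (intro coag_frag_step_in_std_simplex)
          show "rescale n (discrete_step v i j a) \<in> std_simplex"
            using discrete_step_in_simplex[OF that v a(1)] elim(1) by (rule rescale_in_std_simplex)
          show "dist (coag_frag_step (rescale n v) i j u) (rescale n (discrete_step v i j a)) < \<delta>"
            using dist_coag_frag_step_rescale[OF that elim(1) a] elim(2) by simp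
        qed
        then show "\<bar>g (coag_frag_step (rescale n v) i j u) - g (rescale n (discrete_step v i j a))\<bar> \<le> \<epsilon>"
          by (simp add: dist_real_def)
      qed
      have Npos: "?N > 0" using N by simp
      have "\<bar>(\<Sum>(i, j)\<in>?P. ?A i j) - (\<Sum>(i, j)\<in>?P. ?B i j)\<bar> = \<bar>\<Sum>(i, j)\<in>?P. ?A i j - ?B i j\<bar>"
        by (simp add: sum_subtractf case_prod_unfold)
      also have "\<dots> \<le> (\<Sum>(i, j)\<in>?P. \<bar>?A i j - ?B i j\<bar>)"
        unfolding case_prod_unfold by (rule sum_abs)
      also have "\<dots> \<le> (\<Sum>p\<in>?P. \<epsilon>)"
        using pair by (intro sum_mono) (auto simp: abs_minus_commute)
      also have "\<dots> = ?N * \<epsilon>" by (simp only: sum_constant card_distinct_pairs)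
      finally have le: "\<bar>(\<Sum>(i, j)\<in>?P. ?A i j) - (\<Sum>(i, j)\<in>?P. ?B i j)\<bar> \<le> ?N * \<epsilon>" .
      have "\<bar>discrete_operator (\<lambda>w. g (rescale n w)) v - coag_frag_operator g (rescale n v)\<bar>
          = \<bar>(\<Sum>(i, j)\<in>?P. ?A i j) - (\<Sum>(i, j)\<in>?P. ?B i j)\<bar> / ?N"
        unfolding discrete_operator_def coag_frag_operator_def diff_divide_distrib[symmetric] abs_divide
        using Npos by (simp only: abs_of_pos)
      also have "\<dots> \<le> \<epsilon>"
        using le Npos by (simp only: pos_divide_le_eq mult.commute)
      finally show "\<bar>discrete_operator (\<lambda>w. g (rescale n w)) v - coag_frag_operator g (rescale n v)\<bar> \<le> \<epsilon>" .
    qed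
  qed
qed

section \<open>Propagation of convergence in time\<close>

lemma coag_frag_operator_bound:
  fixes g :: "real ^ 'n \<Rightarrow> real"
  assumes N: "CARD('n) \<ge> 2" and g: "g \<in> borel_measurable borel" and bound: "\<And>x. \<bar>g x\<bar> \<le> B"
  shows "\<bar>coag_frag_operator g x\<bar> \<le> B"
proof -
  interpret K: prob_space "coag_frag_kernel x" by (rule prob_space_coag_frag_kernel)
  have m [measurable]: "g \<in> borel_measurable (coag_frag_kernel x)"
    using g by (simp cong: measurable_cong_sets add: sets_coag_frag_kernel)
  have "\<bar>\<integral>y. g y \<partial>coag_frag_kernel x\<bar> \<le> (\<integral>y. \<bar>g y\<bar> \<partial>coag_frag_kernel x)"
    by (rule integral_abs_bound)
  also have "\<dots> \<le> (\<integral>y. B \<partial>coag_frag_kernel x)"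
    by (rule integral_mono) (auto intro!: K.integrable_const_bound[where B = B] simp: m bound)
  finally show ?thesis
    unfolding integral_coag_frag_kernel[OF N g bound, symmetric] by (simp add: K.prob_space)
qed

text \<open>The Feller property, which allows the induction hypothesis to be applied to the image of a
  test function under the transition operator.\<close>

lemma coag_frag_operator_continuous:
  fixes g :: "real ^ 'n \<Rightarrow> real"
  assumes g: "continuous_on UNIV g" and bound: "\<And>x. \<bar>g x\<bar> \<le> B"
  shows "continuous_on UNIV (coag_frag_operator g)"
proof -
  let ?U = "uniform_measure lborel {0..1 :: real}"
  interpret U: prob_space ?U by (rule prob_space_uniform_01)
  have cont: "continuous_on UNIV (\<lambda>(x, u). g (coag_frag_step x i j u))" for i j
    using continuous_on_compose2[OF g continuous_coag_frag_step[of i j]] by (simp add: case_prod_unfold)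
  have "continuous_on UNIV (\<lambda>x. \<integral>u. g (coag_frag_step x i j u) \<partial>?U)" for i j
  proof (rule continuous_on_sequentiallyI)
    fix s and x :: "real ^ 'n" assume s: "s \<longlonglongrightarrow> x"
    show "(\<lambda>n. \<integral>u. g (coag_frag_step (s n) i j u) \<partial>?U) \<longlonglongrightarrow> (\<integral>u. g (coag_frag_step x i j u) \<partial>?U)"
    proof (rule integral_dominated_convergence[where w = "\<lambda>_. B"])
      have "continuous_on UNIV (\<lambda>u. g (coag_frag_step y i j u))" for y
        by (rule continuous_test_of_step[OF g])
      then have "(\<lambda>u. g (coag_frag_step y i j u)) \<in> borel_measurable borel" for y
        by (rule borel_measurable_continuous_onI)
      then show "(\<lambda>u. g (coag_frag_step x i j u)) \<in> borel_measurable ?U"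
        and "\<And>n. (\<lambda>u. g (coag_frag_step (s n) i j u)) \<in> borel_measurable ?U"
        by (auto cong: measurable_cong_sets)
      show "AE u in ?U. (\<lambda>n. g (coag_frag_step (s n) i j u)) \<longlonglongrightarrow> g (coag_frag_step x i j u)"
      proof (rule AE_I2)
        fix u
        have "isCont (\<lambda>(x, u). g (coag_frag_step x i j u)) (x, u)"
          using cont[of i j] by (simp add: continuous_on_eq_continuous_at)
        then show "(\<lambda>n. g (coag_frag_step (s n) i j u)) \<longlonglongrightarrow> g (coag_frag_step x i j u)"
          using isCont_tendsto_compose[OF _ tendsto_Pair[OF s tendsto_const]] by fastforce
      qed
    qed (auto simp: bound)
  qed
  then show ?thesis
    unfolding coag_frag_operator_def case_prod_unfold divide_inverse
    by (intro continuous_on_mult_right continuous_on_sum)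
qed

text \<open>Induction on time, for all test functions at once. Up to an error that vanishes uniformly,
  one step of the discrete chain replaces the test function \<open>g\<close> by \<open>coag_frag_operator g\<close>; one step
  of the limit chain does so exactly.\<close>

lemma coag_frag_expectation_convergence:
  fixes M :: "nat \<Rightarrow> 'a measure" and X :: "nat \<Rightarrow> nat \<Rightarrow> 'a \<Rightarrow> nat ^ 'n"
    and M_inf :: "'b measure" and X_inf :: "nat \<Rightarrow> 'b \<Rightarrow> real ^ 'n"
    and g :: "real ^ 'n \<Rightarrow> real"
  assumes N: "CARD('n) \<ge> 2"
    and chain: "\<And>n. n \<ge> 1 \<Longrightarrow> discrete_coag_frag_chain n (M n) (X n)"
    and chain_inf: "coag_frag_chain M_inf X_inf"
    and init: "\<And>g :: real ^ 'n \<Rightarrow> real. continuous_on UNIV g \<Longrightarrow> bounded (range g) \<Longrightarrow>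
        (\<lambda>n. \<integral>\<omega>. g (rescale n (X n 0 \<omega>)) \<partial>M n) \<longlonglongrightarrow> (\<integral>\<omega>. g (X_inf 0 \<omega>) \<partial>M_inf)"
    and g: "continuous_on UNIV g" "bounded (range g)"
  shows "(\<lambda>n. \<integral>\<omega>. g (rescale n (X n k \<omega>)) \<partial>M n) \<longlonglongrightarrow> (\<integral>\<omega>. g (X_inf k \<omega>) \<partial>M_inf)"
  using g
proof (induction k arbitrary: g)
  case 0
  then show ?case by (rule init)
next
  case (Suc k)
  let ?T = "coag_frag_operator g"
  obtain B where B: "\<And>x. \<bar>g x\<bar> \<le> B" using Suc.prems(2) by (auto simp: bounded_iff)
  have gm: "g \<in> borel_measurable borel" by (rule borel_measurable_continuous_onI[OF Suc.prems(1)])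
  have T: "continuous_on UNIV ?T" "bounded (range ?T)"
    using coag_frag_operator_continuous[OF Suc.prems(1) B] coag_frag_operator_bound[OF N gm B]
    by (auto simp: bounded_iff)
  have IH: "(\<lambda>n. \<integral>\<omega>. ?T (rescale n (X n k \<omega>)) \<partial>M n) \<longlonglongrightarrow> (\<integral>\<omega>. ?T (X_inf k \<omega>) \<partial>M_inf)"
    by (rule Suc.IH[OF T])
  let ?e = "\<lambda>n. (\<integral>\<omega>. g (rescale n (X n (Suc k) \<omega>)) \<partial>M n) - (\<integral>\<omega>. ?T (rescale n (X n k \<omega>)) \<partial>M n)"
  have "?e \<longlonglongrightarrow> 0"
  proof (rule LIMSEQ_I)
    fix r :: real assume "r > 0"
    then have "r / 2 > 0" by simp
    from discrete_operator_approximates[OF N Suc.prems(1) B this] eventually_ge_at_top[of 1]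
    have "\<forall>\<^sub>F n in sequentially. norm (?e n - 0) < r"
    proof eventually_elim
      case (elim n)
      interpret prob_space "M n" using chain[OF elim(2)] by (simp add: discrete_coag_frag_chain_def)
      have Xn: "X n k \<in> M n \<rightarrow>\<^sub>M count_space (discrete_simplex n)"
        using chain[OF elim(2)] by (simp add: discrete_coag_frag_chain_def)
      have int: "integrable (M n) (\<lambda>\<omega>. \<phi> (X n k \<omega>))" for \<phi> :: "nat ^ 'n \<Rightarrow> real"
      proof (rule integrable_const_bound[where B = "\<Sum>v\<in>discrete_simplex n. \<bar>\<phi> v\<bar>"])
        show "(\<lambda>\<omega>. \<phi> (X n k \<omega>)) \<in> borel_measurable (M n)"
          by (rule measurable_compose[OF Xn]) simp
        show "AE \<omega> in M n. norm (\<phi> (X n k \<omega>)) \<le> (\<Sum>v\<in>discrete_simplex n. \<bar>\<phi> v\<bar>)"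
        proof (rule AE_I2)
          fix \<omega> assume "\<omega> \<in> space (M n)"
          then have "X n k \<omega> \<in> discrete_simplex n" using measurable_space[OF Xn] by simp
          then show "norm (\<phi> (X n k \<omega>)) \<le> (\<Sum>v\<in>discrete_simplex n. \<bar>\<phi> v\<bar>)"
            unfolding real_norm_def
            by (rule member_le_sum[where f = "\<lambda>v. \<bar>\<phi> v\<bar>"]) (auto simp: finite_discrete_simplex)
        qed
      qed
      let ?h = "\<lambda>v. discrete_operator (\<lambda>w. g (rescale n w)) v - ?T (rescale n v)"
      have "?e n = (\<integral>\<omega>. ?h (X n k \<omega>) \<partial>M n)"
        using int[of "discrete_operator (\<lambda>w. g (rescale n w))"] int[of "\<lambda>v. ?T (rescale n v)"]
          discrete_chain_expectation_Suc[OF chain[OF elim(2)], of "\<lambda>w. g (rescale n w)" k] by simp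
      also have "\<bar>\<dots>\<bar> \<le> (\<integral>\<omega>. \<bar>?h (X n k \<omega>)\<bar> \<partial>M n)"
        by (rule integral_abs_bound)
      also have "\<dots> \<le> (\<integral>\<omega>. r / 2 \<partial>M n)"
        using elim(1) measurable_space[OF Xn] int[of "\<lambda>v. \<bar>?h v\<bar>"] by (intro integral_mono) auto
      also have "\<dots> < r" using \<open>r > 0\<close> by (simp add: prob_space)
      finally show ?case by simp
    qed
    then show "\<exists>n0. \<forall>n\<ge>n0. norm (?e n - 0) < r" by (simp add: eventually_sequentially)
  qed
  from tendsto_add[OF this IH] show ?case
    unfolding coag_frag_chain_expectation_Suc[OF chain_inf N gm B] by simp
qed

section \<open>Weak convergence on the simplex\<close>

text \<open>By Tietze, test functions on a closed set extend to bounded continuous functions on the whole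
  space. Globally continuous test functions are Borel measurable there and can be composed with the
  steps of both chains without restricting domains.\<close>

lemma weak_conv_on_closed_iff:
  fixes S :: "'s::{metric_space,second_countable_topology} set"
  assumes "closed S" and \<mu>: "\<And>n. n \<ge> 1 \<Longrightarrow> space (\<mu> n) \<subseteq> S" and \<nu>: "space \<nu> \<subseteq> S"
  shows "weak_conv_on S \<mu> \<nu> \<longleftrightarrow>
    (\<forall>g :: 's \<Rightarrow> real. continuous_on UNIV g \<and> bounded (range g) \<longrightarrow>
        (\<lambda>n. \<integral>x. g x \<partial>\<mu> n) \<longlonglongrightarrow> (\<integral>x. g x \<partial>\<nu>))"
    (is "_ \<longleftrightarrow> ?R")
proof
  assume "weak_conv_on S \<mu> \<nu>"
  then show ?R
    unfolding weak_conv_on_def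
    by (meson bounded_subset continuous_on_subset image_mono subset_UNIV)
next
  assume R: ?R
  show "weak_conv_on S \<mu> \<nu>"
    unfolding weak_conv_on_def
  proof (intro allI impI, elim conjE)
    fix f :: "'s \<Rightarrow> real" assume f: "continuous_on S f" "bounded (f ` S)"
    then obtain B where "B > 0" and B: "\<And>x. x \<in> S \<Longrightarrow> norm (f x) \<le> B"
      unfolding bounded_pos by auto
    then obtain g where g: "continuous_on UNIV g" "\<And>x. x \<in> S \<Longrightarrow> g x = f x" "\<And>x. norm (g x) \<le> B"
      using Tietze[OF f(1), of UNIV B] \<open>closed S\<close> by (auto simp: less_imp_le)
    have "(\<lambda>n. \<integral>x. g x \<partial>\<mu> n) \<longlonglongrightarrow> (\<integral>x. g x \<partial>\<nu>)"
      using R g(1,3) by (auto simp: bounded_iff)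
    also have "(\<integral>x. g x \<partial>\<nu>) = (\<integral>x. f x \<partial>\<nu>)"
      using \<nu> g(2) by (intro Bochner_Integration.integral_cong) auto
    finally have lim: "(\<lambda>n. \<integral>x. g x \<partial>\<mu> n) \<longlonglongrightarrow> (\<integral>x. f x \<partial>\<nu>)" .
    have "\<forall>\<^sub>F n in sequentially. (\<integral>x. g x \<partial>\<mu> n) = (\<integral>x. f x \<partial>\<mu> n)"
      using eventually_ge_at_top[of 1]
    proof eventually_elim
      case (elim n)
      then show ?case using \<mu>[OF elim] g(2) by (intro Bochner_Integration.integral_cong) auto
    qed
    with lim show "(\<lambda>n. \<integral>x. f x \<partial>\<mu> n) \<longlonglongrightarrow> (\<integral>x. f x \<partial>\<nu>)" by (rule Lim_transform_eventually)
  qed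
qed

lemma integral_distr_std_simplex:
  fixes g :: "real ^ 'n \<Rightarrow> real"
  assumes "Z \<in> M \<rightarrow>\<^sub>M restrict_space borel std_simplex" "continuous_on UNIV g"
  shows "(\<integral>x. g x \<partial>distr M (restrict_space borel std_simplex) Z) = (\<integral>\<omega>. g (Z \<omega>) \<partial>M)"
  using assms by (intro integral_distr measurable_restrict_space1 borel_measurable_continuous_onI)

lemma measurable_rescale:
  fixes X :: "'a \<Rightarrow> nat ^ 'n"
  assumes "X \<in> M \<rightarrow>\<^sub>M count_space (discrete_simplex n)" "n \<ge> 1"
  shows "(\<lambda>\<omega>. rescale n (X \<omega>)) \<in> M \<rightarrow>\<^sub>M restrict_space borel std_simplex"
proof (rule measurable_compose[OF assms(1)], rule measurable_restrict_space2)
  show "rescale n \<in> space (count_space (discrete_simplex n)) \<rightarrow> std_simplex"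
    using rescale_in_std_simplex[OF _ assms(2)] by auto
qed simp

theorem proposition3:
  fixes M :: "nat \<Rightarrow> 'a measure" and X :: "nat \<Rightarrow> nat \<Rightarrow> 'a \<Rightarrow> nat ^ 'n"
    and Y :: "nat \<Rightarrow> nat \<Rightarrow> 'a \<Rightarrow> real ^ 'n"
    and M_inf :: "'b measure" and X_inf :: "nat \<Rightarrow> 'b \<Rightarrow> real ^ 'n"
    and \<mu>0 :: "nat \<Rightarrow> (real ^ 'n) measure" and \<mu>0_inf :: "(real ^ 'n) measure"
    and k :: nat
  assumes "CARD('n) \<ge> 2"
    and "\<And>n. n \<ge> 1 \<Longrightarrow> discrete_coag_frag_chain n (M n) (X n)"
    and "\<And>n k \<omega>. n \<ge> 1 \<Longrightarrow> Y n k \<omega> = rescale n (X n k \<omega>)"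
    and "\<And>n. n \<ge> 1 \<Longrightarrow> \<mu>0 n = distr (M n) (restrict_space borel std_simplex) (Y n 0)"
    and "coag_frag_chain M_inf X_inf"
    and "\<mu>0_inf = distr M_inf (restrict_space borel std_simplex) (X_inf 0)"
    and "weak_conv_on std_simplex \<mu>0 \<mu>0_inf"
    and "k \<ge> 1"
  shows "weak_conv_on std_simplex
           (\<lambda>n. distr (M n) (restrict_space borel std_simplex) (Y n k))
           (distr M_inf (restrict_space borel std_simplex) (X_inf k))"
proof -
  let ?S = "std_simplex :: (real ^ 'n) set"
  let ?\<mu> = "\<lambda>l n. distr (M n) (restrict_space borel ?S) (Y n l)"
  let ?\<nu> = "\<lambda>l. distr M_inf (restrict_space borel ?S) (X_inf l)"
  have X_inf: "X_inf l \<in> M_inf \<rightarrow>\<^sub>M restrict_space borel ?S" for l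
    using assms(5) by (simp add: coag_frag_chain_def)
  have Y: "Y n l = (\<lambda>\<omega>. rescale n (X n l \<omega>))" if "n \<ge> 1" for n l
    using assms(3)[OF that] by auto
  have Y_meas: "Y n l \<in> M n \<rightarrow>\<^sub>M restrict_space borel ?S" if "n \<ge> 1" for n l
    unfolding Y[OF that] using assms(2)[OF that] that
    by (intro measurable_rescale) (auto simp: discrete_coag_frag_chain_def)
  have closed: "closed ?S" by (rule compact_imp_closed[OF compact_std_simplex])
  have as_expectations: "weak_conv_on ?S (?\<mu> l) (?\<nu> l) \<longleftrightarrow>
    (\<forall>g :: real ^ 'n \<Rightarrow> real. continuous_on UNIV g \<and> bounded (range g) \<longrightarrow>
        (\<lambda>n. \<integral>\<omega>. g (rescale n (X n l \<omega>)) \<partial>M n) \<longlonglongrightarrow> (\<integral>\<omega>. g (X_inf l \<omega>) \<partial>M_inf))" for l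
  proof -
    have "(\<lambda>n. \<integral>x. g x \<partial>?\<mu> l n) \<longlonglongrightarrow> (\<integral>x. g x \<partial>?\<nu> l) \<longleftrightarrow>
      (\<lambda>n. \<integral>\<omega>. g (rescale n (X n l \<omega>)) \<partial>M n) \<longlonglongrightarrow> (\<integral>\<omega>. g (X_inf l \<omega>) \<partial>M_inf)"
      if g: "continuous_on UNIV g" for g :: "real ^ 'n \<Rightarrow> real"
    proof -
      have "\<forall>\<^sub>F n in sequentially. (\<integral>x. g x \<partial>?\<mu> l n) = (\<integral>\<omega>. g (rescale n (X n l \<omega>)) \<partial>M n)"
        using eventually_ge_at_top[of 1]
        by eventually_elim (use integral_distr_std_simplex[OF Y_meas g] Y in simp)
      then show ?thesis
        unfolding integral_distr_std_simplex[OF X_inf g] by (rule tendsto_cong)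
    qed
    then show ?thesis
      by (subst weak_conv_on_closed_iff[OF closed]) (auto simp: space_restrict_space)
  qed
  have "weak_conv_on ?S \<mu>0 \<mu>0_inf \<longleftrightarrow> weak_conv_on ?S (?\<mu> 0) (?\<nu> 0)"
  proof -
    have "(\<lambda>n. \<integral>x. f x \<partial>\<mu>0 n) \<longlonglongrightarrow> c \<longleftrightarrow> (\<lambda>n. \<integral>x. f x \<partial>?\<mu> 0 n) \<longlonglongrightarrow> c"
      for f :: "real ^ 'n \<Rightarrow> real" and c
      by (rule tendsto_cong, rule eventually_mono[OF eventually_ge_at_top[of 1]]) (simp add: assms(4))
    then show ?thesis unfolding weak_conv_on_def assms(6) by simp
  qed
  with assms(7) have "weak_conv_on ?S (?\<mu> 0) (?\<nu> 0)" by simp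
  then show ?thesis
    unfolding as_expectations
    using coag_frag_expectation_convergence[OF assms(1,2,5)] by blast
qed

end
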